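(* Suppose that $n\ge4$. Then for each $3\le k\le n-1$ the discrete imprecise copula $\left(Q(F_n^k),Q(F_n^{k-1})\right)$ is coherent. In particular, it avoids sure loss.
   Context: Let $L_n=\{0,1,\dots,n\}$. A function $C:L_n^2\to[0,n]$ is a discrete copula if (Q1') $C(r,0)=C(0,s)=0$, $C(r,n)=r$, $C(n,s)=s$ for all $r,s\in L_n$, and $C(r_1,s_1)+C(r_2,s_2)\ge C(r_1,s_2)+C(r_2,s_1)$ whenever $r_1\le r_2$, $s_1\le s_2$. A discrete quasi-copula is a function $Q:L_n^2\to[0,n]$ satisfying (Q1'), nondecreasing in each variable and $1$-Lipschitz: $|Q(r_2,s_2)-Q(r_1,s_1)|\le|r_2-r_1|+|s_2-s_1|$. It is proper if it is not a discrete copula. For $1\le k\le n$, $F_n^k$ is the $n\times n$ alternating sign matrix with $(F_n^k)_{ij}=(-1)^{i+j-k-1}$ if $k+1\le i+j\le2n-k+1$ and $|i-j|\le k-1$, and $0$ otherwise. For an alternating sign matrix $A=[a_{ij}]$, $Q(A)(r,s)=\sum_{i=1}^r\sum_{j=1}^s a_{ij}$ (zero if $r=0$ or $s=0$), which is a discrete quasi-copula. A pair $(P,Q)$ of functions $L_n^2\to[0,n]$ is a discrete imprecise copula if both satisfy (Q1') and for all $0\le i\le j\le n$, $0\le k\le l\le n$: $Q(i,k)+P(j,l)-P(i,l)-P(j,k)\ge0$, $P(i,k)+Q(j,l)-P(i,l)-P(j,k)\ge0$, $Q(i,k)+Q(j,l)-Q(i,l)-P(j,k)\ge0$, $Q(i,k)+Q(j,l)-P(i,l)-Q(j,k)\ge0$;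 it is also assumed that $P$ and $Q$ are proper quasi-copulas. Let $\mathcal C(P,Q)$ be the set of all discrete copulas $C$ on $L_n^2$ with $P\le C\le Q$ pointwise. $(P,Q)$ avoids sure loss if $\mathcal C(P,Q)\ne\emptyset$; it is coherent if it avoids sure loss and $P(r,s)=\inf_{C\in\mathcal C(P,Q)}C(r,s)$ and $Q(r,s)=\sup_{C\in\mathcal C(P,Q)}C(r,s)$ for all $r,s\in L_n$. *)

theory Defs
  imports Complex_Main
begin

text \<open>
  A function on \<open>L_n \<times> L_n\<close>, \<open>L_n = {0, 1, \<dots>, n}\<close>, is represented by a function
  \<open>nat \<Rightarrow> nat \<Rightarrow> real\<close> whose values at arguments exceeding \<open>n\<close> are irrelevant: every
  condition below only refers to arguments in \<open>{..n}\<close>.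
\<close>

definition grid_fun :: "nat \<Rightarrow> (nat \<Rightarrow> nat \<Rightarrow> real) \<Rightarrow> bool" where
  "grid_fun n C \<longleftrightarrow> (\<forall>r\<le>n. \<forall>s\<le>n. C r s \<in> {0..real n})"

definition grid_boundary :: "nat \<Rightarrow> (nat \<Rightarrow> nat \<Rightarrow> real) \<Rightarrow> bool" where
  "grid_boundary n C \<longleftrightarrow>
     (\<forall>r\<le>n. \<forall>s\<le>n. C r 0 = 0 \<and> C 0 s = 0 \<and> C r n = real r \<and> C n s = real s)"

definition discrete_copula :: "nat \<Rightarrow> (nat \<Rightarrow> nat \<Rightarrow> real) \<Rightarrow> bool" where
  "discrete_copula n C \<longleftrightarrow>
     grid_fun n C \<and> grid_boundary n C \<and>
     (\<forall>r1 r2 s1 s2. r1 \<le> r2 \<and> r2 \<le> n \<and> s1 \<le> s2 \<and> s2 \<le> n \<longrightarrow>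
        C r1 s1 + C r2 s2 \<ge> C r1 s2 + C r2 s1)"

definition discrete_quasi_copula :: "nat \<Rightarrow> (nat \<Rightarrow> nat \<Rightarrow> real) \<Rightarrow> bool" where
  "discrete_quasi_copula n Q \<longleftrightarrow>
     grid_fun n Q \<and> grid_boundary n Q \<and>
     (\<forall>s\<le>n. \<forall>r1 r2. r1 \<le> r2 \<and> r2 \<le> n \<longrightarrow> Q r1 s \<le> Q r2 s) \<and>
     (\<forall>r\<le>n. \<forall>s1 s2. s1 \<le> s2 \<and> s2 \<le> n \<longrightarrow> Q r s1 \<le> Q r s2) \<and>
     (\<forall>r1\<le>n. \<forall>r2\<le>n. \<forall>s1\<le>n. \<forall>s2\<le>n.
        \<bar>Q r2 s2 - Q r1 s1\<bar> \<le> \<bar>real r2 - real r1\<bar> + \<bar>real s2 - real s1\<bar>)"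

definition proper_discrete_quasi_copula :: "nat \<Rightarrow> (nat \<Rightarrow> nat \<Rightarrow> real) \<Rightarrow> bool" where
  "proper_discrete_quasi_copula n Q \<longleftrightarrow> discrete_quasi_copula n Q \<and> \<not> discrete_copula n Q"

text \<open>
  An \<open>n \<times> n\<close> matrix is a function of row and column indices running from \<open>1\<close> to \<open>n\<close>
  (values at other indices are irrelevant). In \<open>F_mat\<close> the guard makes the truncated
  exponent \<open>i + j - k - 1\<close> agree with the integer one; \<open>2 * n - k + 1\<close> is not truncated
  since \<open>k \<le> n\<close> in all uses.
\<close>

definition F_mat :: "nat \<Rightarrow> nat \<Rightarrow> nat \<Rightarrow> nat \<Rightarrow> int" where
  "F_mat n k i j =
     (if k + 1 \<le> i + j \<and> i + j \<le> 2 * n - k + 1 \<and> \<bar>int i - int j\<bar> \<le> int k - 1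
      then (-1) ^ (i + j - k - 1) else 0)"

definition Q_of_mat :: "(nat \<Rightarrow> nat \<Rightarrow> int) \<Rightarrow> nat \<Rightarrow> nat \<Rightarrow> real" where
  "Q_of_mat A r s = (\<Sum>i=1..r. \<Sum>j=1..s. real_of_int (A i j))"

definition discrete_imprecise_copula ::
    "nat \<Rightarrow> (nat \<Rightarrow> nat \<Rightarrow> real) \<Rightarrow> (nat \<Rightarrow> nat \<Rightarrow> real) \<Rightarrow> bool" where
  "discrete_imprecise_copula n P Q \<longleftrightarrow>
     grid_fun n P \<and> grid_fun n Q \<and> grid_boundary n P \<and> grid_boundary n Q \<and>
     (\<forall>i j k l. i \<le> j \<and> j \<le> n \<and> k \<le> l \<and> l \<le> n \<longrightarrow>
        Q i k + P j l - P i l - P j k \<ge> 0 \<and>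
        P i k + Q j l - P i l - P j k \<ge> 0 \<and>
        Q i k + Q j l - Q i l - P j k \<ge> 0 \<and>
        Q i k + Q j l - P i l - Q j k \<ge> 0) \<and>
     proper_discrete_quasi_copula n P \<and> proper_discrete_quasi_copula n Q"

definition copulas_between ::
    "nat \<Rightarrow> (nat \<Rightarrow> nat \<Rightarrow> real) \<Rightarrow> (nat \<Rightarrow> nat \<Rightarrow> real) \<Rightarrow> (nat \<Rightarrow> nat \<Rightarrow> real) set" where
  "copulas_between n P Q =
     {C. discrete_copula n C \<and> (\<forall>r\<le>n. \<forall>s\<le>n. P r s \<le> C r s \<and> C r s \<le> Q r s)}"

definition avoids_sure_loss ::
    "nat \<Rightarrow> (nat \<Rightarrow> nat \<Rightarrow> real) \<Rightarrow> (nat \<Rightarrow> nat \<Rightarrow> real) \<Rightarrow> bool" where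
  "avoids_sure_loss n P Q \<longleftrightarrow> copulas_between n P Q \<noteq> {}"

definition coherent ::
    "nat \<Rightarrow> (nat \<Rightarrow> nat \<Rightarrow> real) \<Rightarrow> (nat \<Rightarrow> nat \<Rightarrow> real) \<Rightarrow> bool" where
  "coherent n P Q \<longleftrightarrow>
     avoids_sure_loss n P Q \<and>
     (\<forall>r\<le>n. \<forall>s\<le>n. P r s = (INF C\<in>copulas_between n P Q. C r s) \<and>
                    Q r s = (SUP C\<in>copulas_between n P Q. C r s))"

end

theory Submission
  imports Defs
begin

text \<open>
  The corner sums of \<open>F_mat n k\<close> have the closed form
  \<open>min r s\<close> capped with \<open>max 0 (r + s - n) ((r + s - k + 1) div 2)\<close>. Hence \<open>P = Q(F_n^k)\<close> and
  \<open>Q = Q(F_n^(k-1))\<close> differ by at most one, and only where \<open>r + s\<close> has the parity of \<open>k\<close>. The function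
  that equals \<open>P\<close> in even rows and \<open>Q\<close> in odd rows, and the one with the two roles exchanged,
  are both copulas: the increment from a row of one function to the next row of the other is
  \<open>0\<close> up to some column and \<open>1\<close> from there on. At every grid point these two copulas attain
  \<open>P\<close> and \<open>Q\<close>. Attainment gives coherence, and the four inequalities of an imprecise copula follow
  by applying the copula inequality to a copula that attains the bound in question at one corner of the rectangle.
\<close>

section \<open>Closed form of the corner sums: boundary values, monotonicity, Lipschitz
  bound\<close>

definition F_corner :: "int \<Rightarrow> int \<Rightarrow> int \<Rightarrow> int \<Rightarrow> int" where
  "F_corner n k r s = min (min r s) (max (max 0 (r + s - n)) ((r + s - k + 1) div 2))"

lemma F_corner_0 [simp]:
  "0 \<le> s \<Longrightarrow> s \<le> n \<Longrightarrow> F_corner n k 0 s = 0" "0 \<le> r \<Longrightarrow> r \<le> n \<Longrightarrow> F_corner n k r 0 = 0"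
  by (auto simp: F_corner_def)

lemma F_corner_n:
  assumes "1 \<le> k" "0 \<le> r" "r \<le> n"
  shows "F_corner n k r n = r" "F_corner n k n r = r"
  using assms by (auto simp: F_corner_def)

lemma F_corner_mono: "r \<le> r' \<Longrightarrow> s \<le> s' \<Longrightarrow> F_corner n k r s \<le> F_corner n k r' s'"
  unfolding F_corner_def by (intro min.mono max.mono zdiv_mono1) auto

lemma F_corner_antimono: "k \<le> k' \<Longrightarrow> F_corner n k' r s \<le> F_corner n k r s"
  unfolding F_corner_def by (intro min.mono max.mono zdiv_mono1) auto

lemma F_corner_commute: "F_corner n k r s = F_corner n k s r"
  by (simp add: F_corner_def min.commute add.commute)

lemma F_corner_lipschitz:
  assumes "r \<le> r'" shows "F_corner n k r' s \<le> F_corner n k r s + (r' - r)"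
proof -
  have "(r' + s - k + 1) div 2 \<le> (r + s - k + 1) div 2 + (r' - r)"
    using assms by presburger
  thus ?thesis using assms unfolding F_corner_def by linarith
qed

lemma F_corner_bounds: "0 \<le> r \<Longrightarrow> 0 \<le> s \<Longrightarrow> 0 \<le> F_corner n k r s" "F_corner n k r s \<le> r"
  by (auto simp: F_corner_def)

section \<open>Increments between a row for one parameter and the next row for the other\<close>

text \<open>Both values share the same \<open>div\<close> term, so the increment comes from a bound
  that overrides it: the cap while it equals the row index, or \<open>r + s - n\<close> from below.
  The resulting condition is upward closed in \<open>s\<close>.\<close>

lemma F_corner_step_down:
  assumes "0 \<le> r" "r < n" "0 \<le> s" "s \<le> n" "1 \<le> k" "k \<le> n"
  shows "F_corner n k (r + 1) s - F_corner n (k - 1) r s = of_bool (r + k \<le> s \<or> 2 * n - k < r + s)"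
proof -
  \<comment> \<open>Abstracting the floor to an integer with two linear bounds leaves a linear case
    analysis.\<close>
  define t where "t = (r + s - k + 2) div 2"
  have t: "2 * t \<le> r + s - k + 2" "r + s - k + 1 \<le> 2 * t" unfolding t_def by presburger+
  have e: "r + 1 + s - k + 1 = r + s - k + 2" "r + s - (k - 1) + 1 = r + s - k + 2" by auto
  show ?thesis unfolding F_corner_def e t_def[symmetric] of_bool_def using assms t by (smt (verit))
qed

text \<open>Here the \<open>div\<close> term grows by exactly one. The increment is \<open>1\<close>
  unless both values are held at \<open>0\<close> or both are capped at \<open>s\<close>, and this
  exception is downward closed in \<open>s\<close>.\<close>

lemma F_corner_step_up:
  assumes "0 \<le> r" "r < n" "0 \<le> s" "s \<le> n" "1 \<le> k" "k \<le> n"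
  shows "F_corner n (k - 1) (r + 1) s - F_corner n k r s = of_bool (1 \<le> s \<and> k \<le> r + s + 1 \<and> r + 1 < s + k)"
proof -
  define t where "t = (r + s - k + 1) div 2"
  have t: "2 * t \<le> r + s - k + 1" "r + s - k \<le> 2 * t" unfolding t_def by presburger+
  have e: "(r + 1 + s - (k - 1) + 1) div 2 = t + 1" unfolding t_def by presburger
  show ?thesis unfolding F_corner_def e t_def[symmetric] of_bool_def using assms t by (smt (verit))
qed

section \<open>Mixed differences of the closed form are the matrix entries\<close>

text \<open>For fixed \<open>k\<close> the floor moves only at every other row: in this parity class
  the \<open>div\<close> term is the same in both rows, in the opposite class it grows by
  one.\<close>

lemma F_corner_row_increment_even:
  assumes "1 \<le> i" "i \<le> n" "0 \<le> j" "j \<le> n" "1 \<le> k" "k \<le> n" "even (i + j + k)"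
  shows "F_corner n k i j - F_corner n k (i - 1) j = of_bool (2 * n - k < i + j \<or> k + i \<le> j)"
proof -
  define t where "t = (i + j - k) div 2"
  have t: "i + j = 2 * t + k" unfolding t_def using assms by presburger
  have "(i + j - k + 1) div 2 = t" "(i - 1 + j - k + 1) div 2 = t" using t by presburger+
  then show ?thesis unfolding F_corner_def of_bool_def using assms(1-6) t by (smt (verit))
qed

lemma F_corner_row_increment_odd:
  assumes "1 \<le> i" "i \<le> n" "0 \<le> j" "j \<le> n" "1 \<le> k" "k \<le> n" "odd (i + j + k)"
  shows "F_corner n k i j - F_corner n k (i - 1) j = of_bool (k < i + j \<and> i < j + k)"
proof -
  define t where "t = (i + j - k) div 2"
  have t: "i + j = 2 * t + k + 1" unfolding t_def using assms by presburger
  have "(i + j - k + 1) div 2 = t + 1" "(i - 1 + j - k + 1) div 2 = t" using t by presburger+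
  then show ?thesis unfolding F_corner_def of_bool_def using assms(1-6) t by (smt (verit))
qed

text \<open>Columns \<open>j\<close> and \<open>j - 1\<close> have opposite parity, so the two row
  increments come one from each parity class, and the difference of their indicators is the signed
  support.\<close>

lemma F_corner_mixed_difference:
  assumes "1 \<le> i" "i \<le> n" "1 \<le> j" "j \<le> n" "1 \<le> k" "k \<le> n"
  shows "F_corner n k i j - F_corner n k (i - 1) j - F_corner n k i (j - 1) + F_corner n k (i - 1) (j - 1)
    = (if k + 1 \<le> i + j \<and> i + j \<le> 2 * n - k + 1 \<and> \<bar>i - j\<bar> \<le> k - 1
       then if even (i + j + k) then - 1 else 1 else 0)"
proof (cases "even (i + j + k)")
  case True
  \<comment> \<open>The indicators and the support conditions disagree only on these lines, all of
    the wrong parity.\<close>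
  then have parity: "i + j \<noteq> k + 1" "i - j \<noteq> k - 1" "i + j \<noteq> 2 * n - k + 1" by presburger+
  have "F_corner n k i j - F_corner n k (i - 1) j = of_bool (2 * n - k < i + j \<or> k + i \<le> j)"
    by (rule F_corner_row_increment_even) (use assms True in auto)
  moreover have "F_corner n k i (j - 1) - F_corner n k (i - 1) (j - 1) = of_bool (k < i + (j - 1) \<and> i < j - 1 + k)"
    by (rule F_corner_row_increment_odd) (use assms True in presburger)+
  ultimately have "F_corner n k i j - F_corner n k (i - 1) j - F_corner n k i (j - 1) + F_corner n k (i - 1) (j - 1)
    = (if k + 1 \<le> i + j \<and> i + j \<le> 2 * n - k + 1 \<and> \<bar>i - j\<bar> \<le> k - 1 then - 1 else 0)"
    using assms parity unfolding of_bool_def by (smt (verit))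
  then show ?thesis using True by simp
next
  case False
  then have parity: "i + j \<noteq> 2 * n - k + 2" "j - i \<noteq> k" by presburger+
  have "F_corner n k i j - F_corner n k (i - 1) j = of_bool (k < i + j \<and> i < j + k)"
    by (rule F_corner_row_increment_odd) (use assms False in auto)
  moreover have "F_corner n k i (j - 1) - F_corner n k (i - 1) (j - 1) = of_bool (2 * n - k < i + (j - 1) \<or> k + i \<le> j - 1)"
    by (rule F_corner_row_increment_even) (use assms False in presburger)+
  ultimately have "F_corner n k i j - F_corner n k (i - 1) j - F_corner n k i (j - 1) + F_corner n k (i - 1) (j - 1)
    = (if k + 1 \<le> i + j \<and> i + j \<le> 2 * n - k + 1 \<and> \<bar>i - j\<bar> \<le> k - 1 then 1 else 0)"
    using assms parity unfolding of_bool_def by (smt (verit))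
  then show ?thesis using False by simp
qed

lemma F_mat_eq_mixed_difference:
  assumes "1 \<le> i" "i \<le> n" "1 \<le> j" "j \<le> n" "1 \<le> k" "k \<le> n"
  shows "F_corner (int n) (int k) (int i) (int j) - F_corner n k (int i - 1) j - F_corner n k i (int j - 1)
    + F_corner n k (int i - 1) (int j - 1) = F_mat n k i j"
proof -
  \<comment> \<open>On the support the exponent \<open>i + j - k - 1\<close> is not truncated, and
    it is odd exactly when \<open>i + j + k\<close> is even.\<close>
  have "F_mat n k i j =
     (if int k + 1 \<le> int i + int j \<and> int i + int j \<le> 2 * int n - int k + 1 \<and> \<bar>int i - int j\<bar> \<le> int k - 1
       then if even (int i + int j + int k) then - 1 else 1 else 0)"
    unfolding F_mat_def using assms by auto
  then show ?thesis
    using assms by (subst F_corner_mixed_difference) auto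
qed

text \<open>Telescoping along the columns, then along the rows.\<close>

lemma sum_mixed_difference:
  fixes g :: "nat \<Rightarrow> nat \<Rightarrow> 'a :: ab_group_add"
  shows "(\<Sum>i=1..r. \<Sum>j=1..s. g i j - g (i - 1) j - g i (j - 1) + g (i - 1) (j - 1))
    = g r s - g 0 s - g r 0 + g 0 0"
proof -
  have "(\<Sum>j=1..s. g i j - g (i - 1) j - g i (j - 1) + g (i - 1) (j - 1)) =
     (g i s - g i 0) - (g (i - 1) s - g (i - 1) 0)" for i
    by (induction s) (auto simp: algebra_simps)
  moreover have "(\<Sum>i=1..r. (g i s - g i 0) - (g (i - 1) s - g (i - 1) 0)) = g r s - g 0 s - g r 0 + g 0 0"
    by (induction r) (auto simp: algebra_simps)
  ultimately show ?thesis by simp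
qed

text \<open>Summing the mixed differences recovers the closed form because it vanishes on both
  axes.\<close>

lemma Q_of_F_mat:
  assumes "1 \<le> k" "k \<le> n" "r \<le> n" "s \<le> n"
  shows "Q_of_mat (F_mat n k) r s = of_int (F_corner n k r s)"
proof -
  have "Q_of_mat (F_mat n k) r s = of_int (\<Sum>i=1..r. \<Sum>j=1..s. F_mat n k i j)"
    by (simp add: Q_of_mat_def)
  also have "(\<Sum>i=1..r. \<Sum>j=1..s. F_mat n k i j) =
     (\<Sum>i=1..r. \<Sum>j=1..s. F_corner n k (int i) (int j) - F_corner n k (int (i - 1)) (int j)
        - F_corner n k (int i) (int (j - 1)) + F_corner n k (int (i - 1)) (int (j - 1)))"
    by (intro sum.cong refl) (use assms in \<open>auto simp: F_mat_eq_mixed_difference[symmetric] of_nat_diff\<close>)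
  also have "\<dots> = F_corner n k r s"
    by (subst sum_mixed_difference) (use assms in auto)
  finally show ?thesis .
qed

section \<open>Criteria for copulas, coherence and imprecise copulas\<close>

text \<open>Rectangles of height one suffice, since stacking them adds their inequalities.\<close>

lemma discrete_copula_if_row_increments_mono:
  assumes boundary: "grid_boundary n C"
    and incr: "\<And>r s s'. r < n \<Longrightarrow> s \<le> s' \<Longrightarrow> s' \<le> n \<Longrightarrow> C (Suc r) s - C r s \<le> C (Suc r) s' - C r s'"
  shows "discrete_copula n C"
proof -
  have two_incr: "C r s' + C r' s \<le> C r s + C r' s'"
    if "r \<le> r'" "r' \<le> n" "s \<le> s'" "s' \<le> n" for r r' s s'
    using that
  proof (induction r' rule: dec_induct)
    case (step m)
    show ?case using incr[of m s s'] step by simp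
  qed simp
  \<comment> \<open>The rectangle from \<open>(0, 0)\<close> to \<open>(r, s)\<close> gives
    \<open>0 \<le> C r s\<close>; the one from \<open>(0, s)\<close> to \<open>(r, n)\<close> gives
    \<open>C r s \<le> r\<close>.\<close>
  have "C r s \<in> {0..real n}" if "r \<le> n" "s \<le> n" for r s
    using two_incr[of 0 r 0 s] two_incr[of 0 r s n] that boundary
    by (auto simp: grid_boundary_def)
  thus ?thesis using boundary two_incr by (auto simp: discrete_copula_def grid_fun_def)
qed

text \<open>An attained pointwise bound is a minimum or maximum, which fixes \<open>INF\<close> and
  \<open>SUP\<close> in \<open>real\<close> without a separate boundedness argument.\<close>

lemma coherent_if_attained:
  assumes lower: "\<And>r s. r \<le> n \<Longrightarrow> s \<le> n \<Longrightarrow> \<exists>C\<in>copulas_between n P Q. C r s = P r s"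
    and upper: "\<And>r s. r \<le> n \<Longrightarrow> s \<le> n \<Longrightarrow> \<exists>C\<in>copulas_between n P Q. C r s = Q r s"
  shows "coherent n P Q"
proof -
  have "P r s = (INF C\<in>copulas_between n P Q. C r s)" if "r \<le> n" "s \<le> n" for r s
  proof (rule cInf_eq_minimum[symmetric])
    show "P r s \<in> (\<lambda>C. C r s) ` copulas_between n P Q" using lower[OF that] by (metis imageI)
  qed (use that in \<open>auto simp: copulas_between_def\<close>)
  moreover have "Q r s = (SUP C\<in>copulas_between n P Q. C r s)" if "r \<le> n" "s \<le> n" for r s
  proof (rule cSup_eq_maximum[symmetric])
    show "Q r s \<in> (\<lambda>C. C r s) ` copulas_between n P Q" using upper[OF that] by (metis imageI)
  qed (use that in \<open>auto simp: copulas_between_def\<close>)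
  moreover have "copulas_between n P Q \<noteq> {}" using lower[of 0 0] by auto
  ultimately show ?thesis by (auto simp: coherent_def avoids_sure_loss_def)
qed

lemma discrete_imprecise_copula_if_attained:
  assumes P: "proper_discrete_quasi_copula n P" and Q: "proper_discrete_quasi_copula n Q"
    and lower: "\<And>r s. r \<le> n \<Longrightarrow> s \<le> n \<Longrightarrow> \<exists>C\<in>copulas_between n P Q. C r s = P r s"
    and upper: "\<And>r s. r \<le> n \<Longrightarrow> s \<le> n \<Longrightarrow> \<exists>C\<in>copulas_between n P Q. C r s = Q r s"
  shows "discrete_imprecise_copula n P Q"
proof -
  have "Q i k + P j l - P i l - P j k \<ge> 0 \<and> P i k + Q j l - P i l - P j k \<ge> 0 \<and>
        Q i k + Q j l - Q i l - P j k \<ge> 0 \<and> Q i k + Q j l - P i l - Q j k \<ge> 0"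
    if *: "i \<le> j" "j \<le> n" "k \<le> l" "l \<le> n" for i j k l
  proof -
    have le: "i \<le> n" "k \<le> n" using * by auto
    have corners: "C i l + C j k \<le> C i k + C j l" "P i k \<le> C i k" "C i k \<le> Q i k"
       "P i l \<le> C i l" "C i l \<le> Q i l" "P j k \<le> C j k" "C j k \<le> Q j k" "P j l \<le> C j l" "C j l \<le> Q j l"
      if "C \<in> copulas_between n P Q" for C
      using that * le by (auto simp: copulas_between_def discrete_copula_def)
    \<comment> \<open>The harmless choice is \<open>Q\<close> at \<open>(i, k)\<close> and
      \<open>(j, l)\<close> and \<open>P\<close> at \<open>(i, l)\<close> and \<open>(j, k)\<close>.
      Each of the four inequalities departs from it at one corner, and there the copula is chosen to
      attain the bound.\<close>
    obtain C1 where C1: "C1 \<in> copulas_between n P Q" "C1 j l = P j l" using lower * by blast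
    obtain C2 where C2: "C2 \<in> copulas_between n P Q" "C2 i k = P i k" using lower le by blast
    obtain C3 where C3: "C3 \<in> copulas_between n P Q" "C3 i l = Q i l" using upper * le by blast
    obtain C4 where C4: "C4 \<in> copulas_between n P Q" "C4 j k = Q j k" using upper * le by blast
    show ?thesis
      using corners[OF C1(1)] C1(2) corners[OF C2(1)] C2(2) corners[OF C3(1)] C3(2) corners[OF C4(1)] C4(2)
      by (intro conjI; smt (verit))
  qed
  thus ?thesis using P Q unfolding discrete_imprecise_copula_def
    by (simp add: proper_discrete_quasi_copula_def discrete_quasi_copula_def)
qed

section \<open>The corner sums are proper quasi-copulas\<close>

lemma grid_boundary_Q_of_F_mat:
  assumes "1 \<le> k" "k \<le> n"
  shows "grid_boundary n (Q_of_mat (F_mat n k))"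
  using assms by (auto simp: grid_boundary_def Q_of_F_mat F_corner_n)

lemma discrete_quasi_copula_Q_of_F_mat:
  assumes "1 \<le> k" "k \<le> n"
  shows "discrete_quasi_copula n (Q_of_mat (F_mat n k))"
proof -
  let ?g = "\<lambda>r s. F_corner (int n) (int k) (int r) (int s)"
  have "0 \<le> ?g r s \<and> ?g r s \<le> int n" if "r \<le> n" for r s
    using F_corner_bounds(1)[of r s n k] F_corner_bounds(2)[of n k r s] that by linarith
  hence "grid_fun n (Q_of_mat (F_mat n k))"
    using assms by (simp add: grid_fun_def Q_of_F_mat) (metis of_int_le_iff of_int_of_nat_eq)
  moreover have "\<bar>real_of_int (?g r' s') - real_of_int (?g r s)\<bar> \<le> \<bar>real r' - real r\<bar> + \<bar>real s' - real s\<bar>"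
    for r r' s s'
  proof -
    have lipschitz: "\<bar>?g r' s - ?g r s\<bar> \<le> \<bar>int r' - int r\<bar>" for r r' s
      using F_corner_lipschitz[of r r' n k s] F_corner_lipschitz[of r' r n k s]
        F_corner_mono[of r r' s s n k] F_corner_mono[of r' r s s n k] by linarith
    \<comment> \<open>The path goes through \<open>(r, s')\<close>; symmetry turns its column step
      into a row step.\<close>
    have "\<bar>?g r' s' - ?g r s\<bar> \<le> \<bar>?g r' s' - ?g r s'\<bar> + \<bar>?g s' r - ?g s r\<bar>"
      unfolding F_corner_commute[of n k s' r] F_corner_commute[of n k s r] by linarith
    hence "\<bar>?g r' s' - ?g r s\<bar> \<le> \<bar>int r' - int r\<bar> + \<bar>int s' - int s\<bar>"
      using lipschitz[of r' s' r] lipschitz[of s' r s] by linarith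
    hence "real_of_int \<bar>?g r' s' - ?g r s\<bar> \<le> real_of_int (\<bar>int r' - int r\<bar> + \<bar>int s' - int s\<bar>)"
      by (simp only: of_int_le_iff)
    thus ?thesis by simp
  qed
  ultimately show ?thesis
    using assms grid_boundary_Q_of_F_mat[OF assms]
    by (auto simp: discrete_quasi_copula_def Q_of_F_mat intro!: F_corner_mono)
qed

text \<open>A negative entry is a unit square of negative volume, which no copula has. One sits at
  row \<open>2\<close>, column \<open>k\<close>, directly below the \<open>1\<close> of the first
  row in that column.\<close>

lemma proper_discrete_quasi_copula_Q_of_F_mat:
  assumes "2 \<le> k" "k < n"
  shows "proper_discrete_quasi_copula n (Q_of_mat (F_mat n k))"
proof -
  have "F_mat n k 2 k = -1" using assms by (auto simp: F_mat_def)
  hence "F_corner n k 2 k + F_corner n k 1 (int k - 1) < F_corner n k 1 k + F_corner n k 2 (int k - 1)"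
    using F_mat_eq_mixed_difference[of 2 n k k] assms by simp
  hence "Q_of_mat (F_mat n k) 1 (k - 1) + Q_of_mat (F_mat n k) 2 k
       < Q_of_mat (F_mat n k) 1 k + Q_of_mat (F_mat n k) 2 (k - 1)"
    using assms by (simp add: Q_of_F_mat of_nat_diff flip: of_int_add)
  moreover have "(1::nat) \<le> 2" "2 \<le> n" "k - 1 \<le> k" "k \<le> n" using assms by auto
  ultimately have "\<not> discrete_copula n (Q_of_mat (F_mat n k))"
    unfolding discrete_copula_def by (meson not_le)
  thus ?thesis using assms discrete_quasi_copula_Q_of_F_mat[of k n]
    by (simp add: proper_discrete_quasi_copula_def)
qed

section \<open>The two row-alternating copulas\<close>

definition alternate_rows :: "(nat \<Rightarrow> 'a) \<Rightarrow> (nat \<Rightarrow> 'a) \<Rightarrow> nat \<Rightarrow> 'a" where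
  "alternate_rows f g r = (if even r then f r else g r)"

text \<open>Consecutive rows always come one from \<open>P\<close> and one from \<open>Q\<close>, so
  every row increment is covered by \<open>F_corner_step_down\<close> or
  \<open>F_corner_step_up\<close>; both indicators are monotone in the column.\<close>

lemma copulas_between_alternate_rows:
  fixes n k :: nat
  assumes "2 \<le> k" "k \<le> n"
  defines "P \<equiv> Q_of_mat (F_mat n k)" and "Q \<equiv> Q_of_mat (F_mat n (k - 1))"
  shows "alternate_rows P Q \<in> copulas_between n P Q" "alternate_rows Q P \<in> copulas_between n P Q"
proof -
  have P: "P r s = of_int (F_corner n k r s)" if "r \<le> n" "s \<le> n" for r s
    unfolding P_def using that assms by (simp add: Q_of_F_mat)
  have Q: "Q r s = of_int (F_corner n (int k - 1) r s)" if "r \<le> n" "s \<le> n" for r s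
    unfolding Q_def using that assms by (simp add: Q_of_F_mat of_nat_diff)
  have PQ: "P r s \<le> Q r s" if "r \<le> n" "s \<le> n" for r s
    using that by (simp add: P Q F_corner_antimono)
  have down: "P (Suc r) s - Q r s \<le> P (Suc r) s' - Q r s'" if "r < n" "s \<le> s'" "s' \<le> n" for r s s'
  proof -
    have "F_corner n k (int r + 1) s - F_corner n (int k - 1) r s \<le> F_corner n k (int r + 1) s' - F_corner n (int k - 1) r s'"
      using that assms by (simp add: F_corner_step_down)
    thus ?thesis using that by (simp add: P Q add.commute flip: of_int_diff)
  qed
  have up: "Q (Suc r) s - P r s \<le> Q (Suc r) s' - P r s'" if "r < n" "s \<le> s'" "s' \<le> n" for r s s'
  proof -
    have "F_corner n (int k - 1) (int r + 1) s - F_corner n k r s \<le> F_corner n (int k - 1) (int r + 1) s' - F_corner n k r s'"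
      using that assms by (simp add: F_corner_step_up)
    thus ?thesis using that by (simp add: P Q add.commute flip: of_int_diff)
  qed
  have "grid_boundary n P" "grid_boundary n Q"
    unfolding P_def Q_def using assms by (auto intro: grid_boundary_Q_of_F_mat)
  hence "grid_boundary n (alternate_rows P Q)" "grid_boundary n (alternate_rows Q P)"
    by (auto simp: grid_boundary_def alternate_rows_def)
  hence "discrete_copula n (alternate_rows P Q)" "discrete_copula n (alternate_rows Q P)"
    using up down by (auto intro!: discrete_copula_if_row_increments_mono simp: alternate_rows_def)
  thus "alternate_rows P Q \<in> copulas_between n P Q" "alternate_rows Q P \<in> copulas_between n P Q"
    using PQ by (auto simp: copulas_between_def alternate_rows_def)
qed

theorem theorem4p10:
  fixes n k :: nat
  assumes "n \<ge> 4" and "3 \<le> k" and "k \<le> n - 1"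
  shows "discrete_imprecise_copula n (Q_of_mat (F_mat n k)) (Q_of_mat (F_mat n (k - 1))) \<and>
         coherent n (Q_of_mat (F_mat n k)) (Q_of_mat (F_mat n (k - 1))) \<and>
         avoids_sure_loss n (Q_of_mat (F_mat n k)) (Q_of_mat (F_mat n (k - 1)))"
proof -
  let ?P = "Q_of_mat (F_mat n k)" and ?Q = "Q_of_mat (F_mat n (k - 1))"
  have between: "alternate_rows ?P ?Q \<in> copulas_between n ?P ?Q"
      "alternate_rows ?Q ?P \<in> copulas_between n ?P ?Q"
    using copulas_between_alternate_rows[of k n] assms by auto
  \<comment> \<open>The parity of \<open>r\<close> decides which of the two copulas has row
    \<open>r\<close> of \<open>?P\<close>; the other one has row \<open>r\<close> of
    \<open>?Q\<close>.\<close>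
  have lower: "\<exists>C\<in>copulas_between n ?P ?Q. C r s = ?P r s" for r s
    using between by (metis alternate_rows_def)
  have upper: "\<exists>C\<in>copulas_between n ?P ?Q. C r s = ?Q r s" for r s
    using between by (metis alternate_rows_def)
  \<comment> \<open>For \<open>?Q\<close> the negative entry requires \<open>2 \<le> k - 1\<close>,
    which is the hypothesis \<open>3 \<le> k\<close>.\<close>
  have "proper_discrete_quasi_copula n ?P" "proper_discrete_quasi_copula n ?Q"
    using assms by (auto intro!: proper_discrete_quasi_copula_Q_of_F_mat)
  hence "discrete_imprecise_copula n ?P ?Q"
    using lower upper by (rule discrete_imprecise_copula_if_attained)
  moreover have "coherent n ?P ?Q"
    using lower upper by (rule coherent_if_attained)
  ultimately show ?thesis by (simp add: coherent_def)
qed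

end
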